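(* Let $\mathcal X$ be a complex infinite dimensional Banach space, let $m\ge 1$ be an integer, and let $S,T\in B(\mathcal X)$ satisfy $\triangle^m_{T,S}(I)=0$. If $S$ and $T$ are power bounded, then $S$ is polaroid.
   Context: $B(\mathcal X)$ is the algebra of bounded linear operators on $\mathcal X$. For $T,S\in B(\mathcal X)$, $\triangle^m_{T,S}(I)=\sum_{j=0}^m(-1)^j\binom mj T^{m-j}S^{m-j}$. An operator $A$ is power bounded if $\sup_{k\in\mathbb N}\|A^k\|<\infty$. An operator $A$ is polaroid if every isolated point $\lambda$ of its spectrum $\sigma(A)$ is a pole of the resolvent of $A$, i.e. the ascent and the descent of $A-\lambda I$ are both finite (and hence equal). *)

theory Defs
  imports "HOL-Analysis.Analysis" "HOL-Library.Extended_Nat"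
begin

text \<open>
  A complex Banach space is a Banach space whose real scalar multiplication is the restriction of
  a complex one, with the norm homogeneous with respect to complex scalars.
\<close>

class complex_banach = banach +
  fixes scaleC :: "complex \<Rightarrow> 'a \<Rightarrow> 'a"  (infixr "*\<^sub>C" 75)
  assumes scaleC_add_right: "c *\<^sub>C (x + y) = c *\<^sub>C x + c *\<^sub>C y"
    and scaleC_add_left: "(c + d) *\<^sub>C x = c *\<^sub>C x + d *\<^sub>C x"
    and scaleC_scaleC: "c *\<^sub>C (d *\<^sub>C x) = (c * d) *\<^sub>C x"
    and scaleC_one: "1 *\<^sub>C x = x"
    and scaleR_scaleC: "r *\<^sub>R x = of_real r *\<^sub>C x"
    and norm_scaleC: "norm (c *\<^sub>C x) = cmod c * norm x"

interpretation complex_vector: vector_space "scaleC :: complex \<Rightarrow> 'a::complex_banach \<Rightarrow> 'a"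
  by unfold_locales
    (simp_all add: scaleC_add_right scaleC_add_left scaleC_scaleC scaleC_one)

instantiation complex :: complex_banach
begin

definition scaleC_complex :: "complex \<Rightarrow> complex \<Rightarrow> complex"
  where "scaleC_complex c x = c * x"

instance
  by standard
    (simp_all add: scaleC_complex_def algebra_simps norm_mult scaleR_conv_of_real)

end

definition infinite_dimensional :: "'a::complex_banach itself \<Rightarrow> bool"
  where "infinite_dimensional _ \<longleftrightarrow>
    \<not> (\<exists>B::'a set. finite B \<and> complex_vector.span B = UNIV)"

text \<open>Membership in \<open>B(X)\<close>; the operator norm of \<open>A\<close> is \<open>onorm A\<close>.\<close>

definition bounded_clinear :: "('a::complex_banach \<Rightarrow> 'a) \<Rightarrow> bool"
  where "bounded_clinear A \<longleftrightarrow> bounded_linear A \<and> (\<forall>c x. A (c *\<^sub>C x) = c *\<^sub>C A x)"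

definition triangle_op ::
    "nat \<Rightarrow> ('a::complex_banach \<Rightarrow> 'a) \<Rightarrow> ('a \<Rightarrow> 'a) \<Rightarrow> 'a \<Rightarrow> 'a"
  where "triangle_op m T S =
    (\<lambda>x. \<Sum>j=0..m. ((-1) ^ j * of_nat (m choose j)) *\<^sub>C (T ^^ (m - j)) ((S ^^ (m - j)) x))"

definition power_bounded :: "('a::complex_banach \<Rightarrow> 'a) \<Rightarrow> bool"
  where "power_bounded A \<longleftrightarrow> bdd_above (range (\<lambda>k. onorm (A ^^ k)))"

definition shift_op :: "('a::complex_banach \<Rightarrow> 'a) \<Rightarrow> complex \<Rightarrow> 'a \<Rightarrow> 'a"
  where "shift_op A \<mu> = (\<lambda>x. A x - \<mu> *\<^sub>C x)"

definition spectrum_op :: "('a::complex_banach \<Rightarrow> 'a) \<Rightarrow> complex set"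
  where "spectrum_op A =
    {\<mu>. \<not> (\<exists>R. bounded_clinear R \<and> R \<circ> shift_op A \<mu> = id \<and> shift_op A \<mu> \<circ> R = id)}"

text \<open>Ascent and descent are \<open>\<infinity>\<close> when the chain of kernels, respectively ranges, never
  stabilises (the infimum of the empty set in \<^typ>\<open>enat\<close>).\<close>

definition ascent :: "('a::complex_banach \<Rightarrow> 'a) \<Rightarrow> enat"
  where "ascent A = Inf (enat ` {k. {x. (A ^^ k) x = 0} = {x. (A ^^ Suc k) x = 0}})"

definition descent :: "('a::complex_banach \<Rightarrow> 'a) \<Rightarrow> enat"
  where "descent A = Inf (enat ` {k. range (A ^^ k) = range (A ^^ Suc k)})"

definition pole_of_resolvent :: "('a::complex_banach \<Rightarrow> 'a) \<Rightarrow> complex \<Rightarrow> bool"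
  where "pole_of_resolvent A \<mu> \<longleftrightarrow>
    \<mu> \<in> spectrum_op A \<and> ascent (shift_op A \<mu>) < \<infinity> \<and> descent (shift_op A \<mu>) < \<infinity>"

definition polaroid :: "('a::complex_banach \<Rightarrow> 'a) \<Rightarrow> bool"
  where "polaroid A \<longleftrightarrow>
    (\<forall>\<mu>. \<mu> isolated_in spectrum_op A \<longrightarrow> pole_of_resolvent A \<mu>)"

end

theory Submission
  imports Defs
begin

text \<open>
  The sequence \<open>T\<^sup>n S\<^sup>n x\<close> has vanishing \<open>m\<close>-th differences, because
  \<open>T\<^sup>n (\<triangle>\<^sup>m(I)) S\<^sup>n = 0\<close>; so it is polynomial in \<open>n\<close>. Power boundedness makes it
  bounded, hence constant, and comparing \<open>n = 0\<close> with \<open>n = 1\<close> gives \<open>T S = I\<close>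
  (\<open>left_inverse_if_triangle_op_eq_0\<close>). Thus \<open>S\<close> behaves like an isometry, which is captured by one
  estimate, valid for every complex \<open>z\<close> (\<open>shift_op_lower_bound\<close>):
  \<open>\<bar>\<bar>z\<bar> - 1\<bar> \<parallel>x\<parallel> \<le> K \<parallel>(S - z) x\<parallel>\<close>.

  Let \<open>\<mu>\<close> be isolated in the spectrum. If \<open>\<bar>\<mu>\<bar> \<noteq> 1\<close>, the estimate bounds the resolvents uniformly
  at points near \<open>\<mu>\<close>, and a perturbation argument makes \<open>S - \<mu>\<close> invertible, a contradiction
  (\<open>isolated_in_spectrum_op_unimodular\<close>). So \<open>\<bar>\<mu>\<bar> = 1\<close>. Put \<open>A = S - \<mu>\<close>.
  The ascent of \<open>A\<close> is at most 1, since \<open>A\<^sup>2 x = 0\<close> would make \<open>S\<^sup>n x\<close> grow linearly unless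
  \<open>A x = 0\<close> (\<open>shift_op_squared_kernel\<close>).

  For the descent (\<open>range_shift_op_squared\<close>), let \<open>a\<close> be the mean of the resolvent vector
  \<open>(S - z)\<^sup>-\<^sup>1 x\<close> over a small circle about \<open>\<mu>\<close>; it is the constant Laurent coefficient and does
  not depend on the radius. Since \<open>A (S - z)\<^sup>-\<^sup>1 = I + (z - \<mu>) (S - z)\<^sup>-\<^sup>1\<close>, the coefficients at
  \<open>(z - \<mu>)\<^sup>-\<^sup>1\<close> and \<open>(z - \<mu>)\<^sup>-\<^sup>2\<close> are \<open>A a - x\<close> and \<open>A\<^sup>2 a - A x\<close>. The growth of
  the resolvent at the unit circle is at most \<open>K / \<bar>\<bar>z\<bar> - 1\<bar>\<close>. On the circle of radius \<open>r\<close>, a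
  quadratic polynomial in \<open>z - \<mu>\<close> that vanishes where this circle meets the unit circle cancels that
  growth, and letting \<open>r\<close> tend to 0 shows that the coefficient at \<open>(z - \<mu>)\<^sup>-\<^sup>2\<close> vanishes. Hence
  \<open>A\<^sup>2 a = A x\<close>: the range of \<open>A\<close> equals that of \<open>A\<^sup>2\<close>.
\<close>

section \<open>Complex Banach spaces and bounded operators\<close>

lemma bounded_bilinear_scaleC: "bounded_bilinear (scaleC :: complex \<Rightarrow> 'a::complex_banach \<Rightarrow> 'a)"
proof (rule bounded_bilinear.intro)
  show "\<exists>K. \<forall>a b. norm (a *\<^sub>C b :: 'a) \<le> norm a * norm b * K"
    by (rule exI[of _ 1]) (simp add: norm_scaleC)
qed (simp_all add: scaleC_add_left scaleC_add_right scaleR_scaleC[where 'a='a] scaleC_scaleC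
      scaleR_conv_of_real mult.commute)

lemma bounded_linear_scaleC_right: "bounded_linear (\<lambda>x::'a::complex_banach. c *\<^sub>C x)"
  by (rule bounded_bilinear.bounded_linear_right[OF bounded_bilinear_scaleC])

lemma bounded_linear_scaleC_left: "bounded_linear (\<lambda>c. c *\<^sub>C (x::'a::complex_banach))"
  by (rule bounded_bilinear.bounded_linear_left[OF bounded_bilinear_scaleC])

lemmas continuous_on_scaleC = bounded_bilinear.continuous_on[OF bounded_bilinear_scaleC]

lemma bounded_clinearD:
  assumes "bounded_clinear A"
  shows "A (x + y) = A x + A y" "A (x - y) = A x - A y" "A (c *\<^sub>C x) = c *\<^sub>C A x"
    "A (r *\<^sub>R x) = r *\<^sub>R A x" "A 0 = 0" "bounded_linear A"
  using assms
  by (auto simp: bounded_clinear_def bounded_linear.linear linear_add linear_diff linear_0 linear_scale)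

lemma bounded_clinear_shift_op:
  assumes "bounded_clinear A"
  shows "bounded_clinear (shift_op A z)"
  unfolding bounded_clinear_def shift_op_def
proof (intro conjI allI)
  show "bounded_linear (\<lambda>x. A x - z *\<^sub>C x)"
    by (intro bounded_linear_sub bounded_linear_scaleC_right bounded_clinearD(6)[OF assms])
qed (simp add: bounded_clinearD[OF assms] scaleC_scaleC mult.commute
      complex_vector.scale_right_diff_distrib)

lemma bounded_linear_funpow: "bounded_linear A \<Longrightarrow> bounded_linear (A ^^ k)"
  for A :: "'a::real_normed_vector \<Rightarrow> 'a"
proof (induction k)
  case 0
  then show ?case by (simp add: id_def bounded_linear_ident)
next
  case (Suc k)
  then show ?case using bounded_linear_compose[of A "A ^^ k"] by (simp add: o_def)
qed

lemma power_boundedE: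
  assumes "bounded_clinear A" "power_bounded A"
  obtains M where "M \<ge> 0" "\<And>k x. norm ((A ^^ k) x) \<le> M * norm x"
proof -
  obtain M where M: "\<And>k. onorm (A ^^ k) \<le> M"
    using assms(2) by (auto simp: power_bounded_def bdd_above_def)
  have bl: "bounded_linear (A ^^ k)" for k
    using assms(1) bounded_linear_funpow by (auto simp: bounded_clinear_def)
  have "norm ((A ^^ k) x) \<le> M * norm x" for k x
    using onorm[OF bl, of k x] M[of k] by (meson mult_right_mono norm_ge_zero order_trans)
  moreover have "M \<ge> 0" using onorm_pos_le[OF bl, of 0] M[of 0] by simp
  ultimately show thesis using that by blast
qed

section \<open>Bounded sequences with vanishing higher differences\<close>

text \<open>
  The sum is the \<open>m\<close>-th forward difference of \<open>b\<close> at \<open>n\<close>; the recursion, which is Pascal's rule,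
  identifies it as an iterated difference.
\<close>

lemma alternating_binomial_sum_Suc:
  fixes b :: "nat \<Rightarrow> 'a::complex_banach"
  defines "w \<equiv> \<lambda>m n. \<Sum>j=0..m. ((-1) ^ j * of_nat (m choose j)) *\<^sub>C b (n + (m - j))"
  shows "w (Suc m) n = w m (Suc n) - w m n"
proof -
  let ?c = "\<lambda>k j. ((-1) ^ j * of_nat (k choose j)) :: complex"
  have "w (Suc m) n = b (n + Suc m) + (\<Sum>j=0..m. ?c (Suc m) (Suc j) *\<^sub>C b (n + (m - j)))"
    unfolding w_def by (subst sum.atLeast0_atMost_Suc_shift) (simp add: scaleC_one)
  also have "(\<Sum>j=0..m. ?c (Suc m) (Suc j) *\<^sub>C b (n + (m - j))) =
      (\<Sum>j=0..m. ?c m (Suc j) *\<^sub>C b (n + (m - j))) - w m n"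
    unfolding w_def sum_subtractf[symmetric]
    by (rule sum.cong)
      (simp_all add: algebra_simps complex_vector.scale_left_diff_distrib complex_vector.scale_minus_left)
  also have "(\<Sum>j=0..m. ?c m (Suc j) *\<^sub>C b (n + (m - j))) = w m (Suc n) - b (n + Suc m)"
  proof -
    have "w m (Suc n) = (\<Sum>j=0..Suc m. ?c m j *\<^sub>C b (n + (Suc m - j)))"
      unfolding w_def by (simp add: Suc_diff_le)
    also have "\<dots> = b (n + Suc m) + (\<Sum>j=0..m. ?c m (Suc j) *\<^sub>C b (n + (m - j)))"
      by (subst sum.atLeast0_atMost_Suc_shift) (simp add: scaleC_one)
    finally show ?thesis by simp
  qed
  finally show ?thesis by simp
qed

lemma bounded_increments_eq_0:
  fixes v :: "'a::real_normed_vector"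
  assumes "\<And>n. norm (u + real n *\<^sub>R v) \<le> K"
  shows "v = 0"
proof (rule ccontr)
  assume "v \<noteq> 0"
  obtain n where n: "(K + norm u) / norm v < real n"
    using reals_Archimedean2 by blast
  have "real n * norm v \<le> norm (u + real n *\<^sub>R v) + norm u"
    using norm_triangle_ineq4[of "u + real n *\<^sub>R v" u] by simp
  with assms[of n] n \<open>v \<noteq> 0\<close> show False by (simp add: field_simps)
qed

text \<open>
  The order of the vanishing difference can be lowered one step at a time: if the difference of order
  \<open>k + 2\<close> vanishes, then the one of order \<open>k\<close> is an arithmetic progression, and being bounded it has
  step 0, so the difference of order \<open>k + 1\<close> vanishes as well.
\<close>

lemma bounded_seq_const_if_difference_eq_0:
  fixes b :: "nat \<Rightarrow> 'a::complex_banach"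
  assumes bdd: "\<And>n. norm (b n) \<le> K"
    and zero: "\<And>n. (\<Sum>j=0..Suc m. ((-1) ^ j * of_nat (Suc m choose j)) *\<^sub>C b (n + (Suc m - j))) = 0"
  shows "b (Suc n) = b n"
  using zero
proof (induction m)
  case 0
  from this[of n] show ?case
    by (simp add: scaleC_one complex_vector.scale_minus_left)
next
  case (Suc m)
  define w where "w = (\<lambda>m n. \<Sum>j=0..m. ((-1) ^ j * of_nat (m choose j)) *\<^sub>C b (n + (m - j)))"
  have w_Suc: "w (Suc k) n = w k (Suc n) - w k n" for k n
    unfolding w_def by (rule alternating_binomial_sum_Suc)
  have bounded_w: "\<exists>L. \<forall>n. norm (w k n) \<le> L" for k
  proof (induction k)
    case 0
    show ?case using bdd by (auto simp: w_def scaleC_one intro!: exI[of _ K])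
  next
    case (Suc k)
    then obtain L where L: "norm (w k n) \<le> L" for n by blast
    have "norm (w (Suc k) n) \<le> L + L" for n
      unfolding w_Suc by (rule norm_triangle_le_diff) (intro add_mono L)
    then show ?case by blast
  qed
  have const: "w (Suc m) (Suc n) = w (Suc m) n" for n
    using Suc.prems[of n] w_Suc[of "Suc m" n] unfolding w_def by simp
  show ?case
  proof (rule Suc.IH)
    fix n
    obtain L where L: "norm (w m n) \<le> L" for n using bounded_w by blast
    have const': "w (Suc m) k = w (Suc m) 0" for k
      using const by (induction k) simp_all
    have "w m k = w m 0 + real k *\<^sub>R w (Suc m) 0" for k
    proof (induction k)
      case (Suc k)
      have "w m (Suc k) = w m k + w (Suc m) k" by (simp add: w_Suc)
      then show ?case using Suc const'[of k] by (simp add: algebra_simps)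
    qed simp
    then have "norm (w m 0 + real k *\<^sub>R w (Suc m) 0) \<le> L" for k
      using L by metis
    then have "w (Suc m) 0 = 0" by (rule bounded_increments_eq_0)
    then have "w (Suc m) n = 0" using const' by simp
    then show "(\<Sum>j=0..Suc m. ((-1) ^ j * of_nat (Suc m choose j)) *\<^sub>C b (n + (Suc m - j))) = 0"
      by (simp add: w_def)
  qed
qed

section \<open>The operator as an isometry up to constants\<close>

text \<open>
  The \<open>m\<close>-th differences of \<open>T\<^sup>n S\<^sup>n x\<close> are the vectors \<open>T\<^sup>n (\<triangle>\<^sup>m(I)) S\<^sup>n x = 0\<close>, and
  the sequence is bounded, so its first two terms \<open>x\<close> and \<open>T S x\<close> agree.
\<close>

lemma left_inverse_if_triangle_op_eq_0:
  assumes S: "bounded_clinear S" and T: "bounded_clinear T"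
    and "m \<ge> 1" and tri: "triangle_op m T S = (\<lambda>x. 0)"
    and "power_bounded S" and "power_bounded T"
  shows "T (S x) = x"
proof -
  obtain m' where m: "m = Suc m'" using \<open>m \<ge> 1\<close> by (cases m) auto
  obtain M where M: "M \<ge> 0" "\<And>k x. norm ((S ^^ k) x) \<le> M * norm x"
    using power_boundedE S \<open>power_bounded S\<close> by blast
  obtain N where N: "N \<ge> 0" "\<And>k x. norm ((T ^^ k) x) \<le> N * norm x"
    using power_boundedE T \<open>power_bounded T\<close> by blast
  define b where "b = (\<lambda>n. (T ^^ n) ((S ^^ n) x))"
  have "norm (b n) \<le> N * (M * norm x)" for n
    unfolding b_def by (rule order_trans[OF N(2) mult_left_mono[OF M(2) N(1)]])
  moreover have "(\<Sum>j=0..Suc m'. ((-1) ^ j * of_nat (Suc m' choose j)) *\<^sub>C b (n + (Suc m' - j))) = 0" for n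
  proof -
    have lin: "linear (T ^^ n)"
      using bounded_linear_funpow[of T n] T
      by (auto simp: bounded_clinear_def bounded_linear.linear)
    have sc: "(T ^^ n) (c *\<^sub>C y) = c *\<^sub>C (T ^^ n) y" for c y
      using T by (induction n) (auto simp: bounded_clinear_def)
    have "0 = (T ^^ n) (triangle_op m T S ((S ^^ n) x))"
      by (simp add: tri linear_0[OF lin])
    also have "\<dots> = (\<Sum>j=0..m. ((-1) ^ j * of_nat (m choose j)) *\<^sub>C
        (T ^^ n) ((T ^^ (m - j)) ((S ^^ (m - j)) ((S ^^ n) x))))"
      by (simp add: triangle_op_def linear_sum[OF lin] sc)
    also have "\<dots> = (\<Sum>j=0..m. ((-1) ^ j * of_nat (m choose j)) *\<^sub>C b (n + (m - j)))"
      by (simp add: b_def funpow_add add.commute[of n] flip: funpow_swap1)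
         (simp add: funpow_add[symmetric, unfolded o_def, THEN fun_cong] add.commute)
    finally show ?thesis by (simp add: m)
  qed
  ultimately have "b (Suc 0) = b 0"
    by (rule bounded_seq_const_if_difference_eq_0)
  then show ?thesis by (simp add: b_def)
qed

text \<open>
  A substitute for summing the Neumann series of \<open>(I - c L)\<^sup>-\<^sup>1\<close>: all vectors \<open>L\<^sup>k x\<close> satisfy the
  same affine recursion, so the supremum of their norms is bounded by itself times \<open>\<bar>c\<bar>\<close> plus
  \<open>M \<parallel>y\<parallel>\<close>.
\<close>

lemma norm_le_if_fixed_affine:
  fixes L :: "'a::complex_banach \<Rightarrow> 'a"
  assumes L: "bounded_clinear L" and M: "\<And>k x. norm ((L ^^ k) x) \<le> M * norm x"
    and x: "x = y + c *\<^sub>C L x" and c: "cmod c < 1"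
  shows "(1 - cmod c) * norm x \<le> M * norm y"
proof -
  define s where "s = (SUP k. norm ((L ^^ k) x))"
  have bdd: "bdd_above (range (\<lambda>k. norm ((L ^^ k) x)))"
    using M by (auto simp: bdd_above_def)
  have le_s: "norm ((L ^^ k) x) \<le> s" for k
    unfolding s_def by (rule cSUP_upper[OF _ bdd]) simp
  have "norm ((L ^^ k) x) \<le> M * norm y + cmod c * s" for k
  proof -
    have lin: "linear (L ^^ k)"
      using bounded_linear_funpow[of L k] L
      by (auto simp: bounded_clinear_def bounded_linear.linear)
    have sc: "(L ^^ k) (c *\<^sub>C y) = c *\<^sub>C (L ^^ k) y" for c y
      using L by (induction k) (auto simp: bounded_clinear_def)
    have "(L ^^ k) x = (L ^^ k) (y + c *\<^sub>C L x)" using x by simp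
    also have "\<dots> = (L ^^ k) y + c *\<^sub>C (L ^^ Suc k) x"
      by (simp only: linear_add[OF lin] sc funpow_Suc_right o_def)
    finally have "norm ((L ^^ k) x) \<le> norm ((L ^^ k) y) + cmod c * norm ((L ^^ Suc k) x)"
      by (metis norm_triangle_ineq norm_scaleC)
    also have "\<dots> \<le> M * norm y + cmod c * s"
      by (intro add_mono M mult_left_mono le_s) simp
    finally show ?thesis .
  qed
  then have "s \<le> M * norm y + cmod c * s"
    unfolding s_def by (intro cSUP_least) auto
  moreover have "(1 - cmod c) * norm x \<le> (1 - cmod c) * s"
    using le_s[of 0] c by (intro mult_left_mono) auto
  ultimately show ?thesis by (simp add: algebra_simps)
qed

text \<open>
  Inside the unit disc the equation \<open>y = S x - z x\<close> is solved for \<open>x\<close> by applying \<open>T\<close>, outside by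
  dividing by \<open>z\<close>. Either way \<open>x\<close> is a fixed point to which the previous bound applies, with ratio
  \<open>\<bar>z\<bar>\<close> and \<open>1 / \<bar>z\<bar>\<close> respectively.
\<close>

lemma shift_op_lower_bound:
  fixes S T :: "'a::complex_banach \<Rightarrow> 'a"
  assumes S: "bounded_clinear S" and T: "bounded_clinear T" and TS: "\<And>x. T (S x) = x"
    and M: "\<And>k x. norm ((S ^^ k) x) \<le> M * norm x"
    and N: "\<And>k x. norm ((T ^^ k) x) \<le> N * norm x"
    and "M \<ge> 0" "N \<ge> 0"
  shows "\<bar>cmod z - 1\<bar> * norm x \<le> (M + N * N) * norm (shift_op S z x)"
proof -
  let ?y = "shift_op S z x"
  have NN: "0 \<le> N * N" using \<open>N \<ge> 0\<close> by simp
  consider "cmod z < 1" | "cmod z = 1" | "cmod z > 1" by linarith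
  then show ?thesis
  proof cases
    case 1
    have "x = T ?y + z *\<^sub>C T x"
      using T TS by (simp add: shift_op_def bounded_clinear_def bounded_linear.linear linear_diff)
    from norm_le_if_fixed_affine[OF T N this 1]
    have "(1 - cmod z) * norm x \<le> N * norm (T ?y)" .
    also have "\<dots> \<le> N * (N * norm ?y)"
      using N[of 1 ?y] \<open>N \<ge> 0\<close> by (intro mult_left_mono) auto
    also have "\<dots> \<le> (M + N * N) * norm ?y"
      using \<open>M \<ge> 0\<close> by (simp add: algebra_simps)
    finally show ?thesis using 1 by simp
  next
    case 2
    then show ?thesis using NN \<open>M \<ge> 0\<close> by simp
  next
    case 3
    then have "z \<noteq> 0" by auto
    then have "x = (- inverse z) *\<^sub>C ?y + inverse z *\<^sub>C S x"
      by (simp add: shift_op_def complex_vector.scale_right_diff_distrib scaleC_scaleC scaleC_one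
          complex_vector.scale_minus_left)
    moreover have "cmod (inverse z) < 1" using 3 by (simp add: norm_inverse inverse_less_1_iff)
    ultimately have "(1 - cmod (inverse z)) * norm x \<le> M * norm ((- inverse z) *\<^sub>C ?y)"
      by (intro norm_le_if_fixed_affine[OF S M])
    then have "cmod z * ((1 - cmod (inverse z)) * norm x) \<le> cmod z * (M * (cmod (inverse z) * norm ?y))"
      unfolding norm_scaleC by (intro mult_left_mono) auto
    moreover have "cmod z * cmod (inverse z) = 1" using \<open>z \<noteq> 0\<close> by (simp add: norm_inverse)
    ultimately have "(cmod z - 1) * norm x \<le> M * norm ?y"
      by (simp add: algebra_simps) (metis mult.assoc mult.left_commute mult_1)
    also have "\<dots> \<le> (M + N * N) * norm ?y"
      using NN by (intro mult_right_mono) auto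
    finally show ?thesis using 3 by simp
  qed
qed

section \<open>The resolvent as a holomorphic function\<close>

text \<open>
  This is \<open>(A - z)\<^sup>-\<^sup>1\<close>, with the opposite sign to the other usual convention, and is meaningful
  only off the spectrum.
\<close>

definition resolvent_op :: "('a::complex_banach \<Rightarrow> 'a) \<Rightarrow> complex \<Rightarrow> 'a \<Rightarrow> 'a"
  where "resolvent_op A z = inv (shift_op A z)"

lemma resolvent_op_inverse:
  assumes "z \<notin> spectrum_op A"
  shows bounded_clinear_resolvent_op: "bounded_clinear (resolvent_op A z)"
    and shift_op_resolvent_op: "shift_op A z (resolvent_op A z x) = x"
    and resolvent_op_shift_op: "resolvent_op A z (shift_op A z x) = x"
proof -
  obtain R where R: "bounded_clinear R" "R \<circ> shift_op A z = id" "shift_op A z \<circ> R = id"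
    using assms by (auto simp: spectrum_op_def)
  have "resolvent_op A z = R"
    unfolding resolvent_op_def by (rule inv_unique_comp) (use R in auto)
  with R(1) show "bounded_clinear (resolvent_op A z)" by simp
  from \<open>resolvent_op A z = R\<close> R(2,3) show
    "shift_op A z (resolvent_op A z x) = x" "resolvent_op A z (shift_op A z x) = x"
    by (auto simp: fun_eq_iff)
qed

lemma resolvent_identity:
  assumes z: "z \<notin> spectrum_op A" and w: "w \<notin> spectrum_op A"
  shows "resolvent_op A z x - resolvent_op A w x =
    (z - w) *\<^sub>C resolvent_op A z (resolvent_op A w x)"
proof -
  let ?u = "resolvent_op A w x"
  have "x = shift_op A z ?u + (z - w) *\<^sub>C ?u"
    using shift_op_resolvent_op[OF w, of x]
    by (simp add: shift_op_def complex_vector.scale_left_diff_distrib algebra_simps)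
  then have "resolvent_op A z x = resolvent_op A z (shift_op A z ?u + (z - w) *\<^sub>C ?u)"
    by simp
  also have "\<dots> = ?u + (z - w) *\<^sub>C resolvent_op A z ?u"
    by (simp add: bounded_clinearD[OF bounded_clinear_resolvent_op[OF z]] resolvent_op_shift_op[OF z])
  finally show ?thesis by simp
qed

text \<open>
  The resolvent identity bounds \<open>\<parallel>(A - w)\<^sup>-\<^sup>1 x\<parallel>\<close> by a fixed multiple of \<open>\<parallel>x\<parallel>\<close> plus half of itself
  when \<open>w\<close> is close to \<open>z\<close>.
\<close>

lemma resolvent_op_locally_bounded:
  assumes z: "z \<notin> spectrum_op A"
  obtains C e where "C > 0" "e > 0"
    "\<And>w x. w \<notin> spectrum_op A \<Longrightarrow> cmod (w - z) < e \<Longrightarrow> norm (resolvent_op A w x) \<le> C * norm x"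
proof -
  obtain K where K: "K > 0" "\<And>x. norm (resolvent_op A z x) \<le> norm x * K"
    using bounded_linear.pos_bounded[OF bounded_clinearD(6)[OF bounded_clinear_resolvent_op[OF z]]] by blast
  show thesis
  proof (rule that[of "2 * K" "1 / (2 * K)"])
    fix w x
    assume w: "w \<notin> spectrum_op A" and d: "cmod (w - z) < 1 / (2 * K)"
    let ?y = "resolvent_op A w x"
    have "norm (resolvent_op A z x - ?y) \<le> cmod (z - w) * (norm ?y * K)"
      unfolding resolvent_identity[OF z w] norm_scaleC by (intro mult_left_mono K) simp
    also have "\<dots> \<le> 1 / (2 * K) * (norm ?y * K)"
      using d K(1) by (intro mult_right_mono) (auto simp: norm_minus_commute)
    also have "\<dots> = norm ?y / 2" using K(1) by simp
    finally have "norm ?y \<le> norm (resolvent_op A z x) + norm ?y / 2"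
      using norm_triangle_ineq2[of ?y "resolvent_op A z x"] by (simp add: norm_minus_commute)
    moreover have "norm (resolvent_op A z x) \<le> K * norm x"
      using K(2)[of x] by (simp add: mult.commute)
    ultimately show "norm ?y \<le> 2 * K * norm x" by linarith
  qed (use K in auto)
qed

lemma resolvent_op_tendsto:
  assumes z: "z \<notin> spectrum_op A"
  shows "((\<lambda>w. resolvent_op A w x) \<longlongrightarrow> resolvent_op A z x) (at z within - spectrum_op A)"
proof -
  obtain C e where C: "C > 0" "e > 0"
    "\<And>w x. w \<notin> spectrum_op A \<Longrightarrow> cmod (w - z) < e \<Longrightarrow> norm (resolvent_op A w x) \<le> C * norm x"
    using resolvent_op_locally_bounded[OF z] by blast
  have "((\<lambda>w. resolvent_op A w x - resolvent_op A z x) \<longlongrightarrow> 0) (at z within - spectrum_op A)"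
  proof (rule Lim_null_comparison)
    show "eventually (\<lambda>w. norm (resolvent_op A w x - resolvent_op A z x) \<le>
        cmod (w - z) * (C * norm (resolvent_op A z x))) (at z within - spectrum_op A)"
      using \<open>e > 0\<close> unfolding eventually_at
      by (intro exI[of _ e])
         (auto simp: resolvent_identity[OF _ z] norm_scaleC dist_norm intro!: mult_left_mono C)
    show "((\<lambda>w. cmod (w - z) * (C * norm (resolvent_op A z x))) \<longlongrightarrow> 0) (at z within - spectrum_op A)"
      by (auto intro!: tendsto_eq_intros)
  qed
  then show ?thesis by (simp add: LIM_zero_iff)
qed

lemma resolvent_op_has_derivative:
  assumes z: "z \<notin> spectrum_op A"
  shows "((\<lambda>w. resolvent_op A w x) has_derivative
    (\<lambda>h. h *\<^sub>C resolvent_op A z (resolvent_op A z x))) (at z within - spectrum_op A)"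
  unfolding has_derivative_within_alt
proof (intro conjI allI impI bounded_linear_scaleC_left)
  fix e :: real
  assume "e > 0"
  let ?u = "resolvent_op A z x"
  obtain d where d0: "d > 0" "\<And>w. w \<notin> spectrum_op A \<Longrightarrow> w \<noteq> z \<Longrightarrow> cmod (w - z) < d \<Longrightarrow>
      norm (resolvent_op A w ?u - resolvent_op A z ?u) < e"
    using tendstoD[OF resolvent_op_tendsto[OF z, of ?u] \<open>e > 0\<close>]
    by (auto simp: eventually_at dist_norm)
  have d: "norm (resolvent_op A w ?u - resolvent_op A z ?u) \<le> e"
    if "w \<notin> spectrum_op A" "cmod (w - z) < d" for w
    using d0(2)[of w] that \<open>e > 0\<close> by (cases "w = z") auto
  have "norm (resolvent_op A w x - ?u - (w - z) *\<^sub>C resolvent_op A z ?u) \<le> e * cmod (w - z)"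
    if "w \<notin> spectrum_op A" "cmod (w - z) < d" for w
  proof -
    have "resolvent_op A w x - ?u - (w - z) *\<^sub>C resolvent_op A z ?u =
        (w - z) *\<^sub>C (resolvent_op A w ?u - resolvent_op A z ?u)"
      by (simp only: resolvent_identity[OF that(1) z, of x] complex_vector.scale_right_diff_distrib)
    then show ?thesis
      using mult_left_mono[OF d[OF that], of "cmod (w - z)"]
      by (simp add: norm_scaleC mult.commute)
  qed
  with d0(1) show "\<exists>d>0. \<forall>w\<in>- spectrum_op A. norm (w - z) < d \<longrightarrow>
      norm (resolvent_op A w x - ?u - (w - z) *\<^sub>C resolvent_op A z ?u) \<le> e * norm (w - z)"
    by auto
qed

lemma continuous_on_resolvent_op_twice:
  "continuous_on (- spectrum_op A) (\<lambda>w. resolvent_op A w (resolvent_op A w x))"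
  unfolding continuous_on_def
proof
  fix z
  assume "z \<in> - spectrum_op A"
  then have z: "z \<notin> spectrum_op A" by simp
  obtain C e where C: "C > 0" "e > 0"
    "\<And>w x. w \<notin> spectrum_op A \<Longrightarrow> cmod (w - z) < e \<Longrightarrow> norm (resolvent_op A w x) \<le> C * norm x"
    using resolvent_op_locally_bounded[OF z] by blast
  let ?F = "at z within - spectrum_op A" and ?u = "resolvent_op A z x"
  have "((\<lambda>w. resolvent_op A w (resolvent_op A w x - ?u)) \<longlongrightarrow> 0) ?F"
  proof (rule Lim_null_comparison)
    show "eventually (\<lambda>w. norm (resolvent_op A w (resolvent_op A w x - ?u)) \<le>
        C * norm (resolvent_op A w x - ?u)) ?F"
      using C unfolding eventually_at by (intro exI[of _ e]) (auto simp: dist_norm)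
    have "((\<lambda>w. resolvent_op A w x - ?u) \<longlongrightarrow> 0) ?F"
      using resolvent_op_tendsto[OF z] by (simp add: LIM_zero_iff)
    from tendsto_mult_left[OF tendsto_norm[OF this], of C]
    show "((\<lambda>w. C * norm (resolvent_op A w x - ?u)) \<longlongrightarrow> 0) ?F" by simp
  qed
  from tendsto_add[OF this resolvent_op_tendsto[OF z, of ?u]]
  have "((\<lambda>w. resolvent_op A w (resolvent_op A w x - ?u) + resolvent_op A w ?u) \<longlongrightarrow>
      resolvent_op A z ?u) ?F" by simp
  then show "((\<lambda>w. resolvent_op A w (resolvent_op A w x)) \<longlongrightarrow> resolvent_op A z ?u) ?F"
  proof (rule Lim_transform_eventually)
    show "eventually (\<lambda>w. resolvent_op A w (resolvent_op A w x - ?u) + resolvent_op A w ?u =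
        resolvent_op A w (resolvent_op A w x)) ?F"
      unfolding eventually_at
      by (intro exI[of _ 1]) (auto simp: bounded_clinearD[OF bounded_clinear_resolvent_op])
  qed
qed

text \<open>
  Cauchy's theorem for concentric circles, with values in a Banach space. Differentiation under the
  integral sign gives \<open>\<integral> e\<^sup>i\<^sup>t f'(\<mu> + r e\<^sup>i\<^sup>t) dt\<close> as the derivative in \<open>r\<close>. Up to the factor
  \<open>i r\<close> the integrand is the derivative in \<open>t\<close> of the periodic function \<open>f(\<mu> + r e\<^sup>i\<^sup>t)\<close>, so the
  integral is 0. Integrating against \<open>dt\<close> rather than \<open>dz\<close> picks out the constant Laurent coefficient.
\<close>

lemma circle_integral_radius_independent:
  fixes f f' :: "complex \<Rightarrow> 'a::complex_banach"
  assumes der: "\<And>z. z \<in> ball \<mu> \<delta> - {\<mu>} \<Longrightarrow> (f has_derivative (\<lambda>h. h *\<^sub>C f' z)) (at z)"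
    and cont: "continuous_on (ball \<mu> \<delta> - {\<mu>}) f'"
  obtains J where "\<And>r. 0 < r \<Longrightarrow> r < \<delta> \<Longrightarrow> ((\<lambda>t. f (\<mu> + of_real r * cis t)) has_integral J) {0..2*pi}"
proof -
  let ?p = "\<lambda>r t. \<mu> + of_real r * cis t"
  have p: "?p r t \<in> ball \<mu> \<delta> - {\<mu>}" if "r \<in> {0<..<\<delta>}" for r t
    using that by (auto simp: dist_norm norm_mult)
  have cont_f: "continuous_on (ball \<mu> \<delta> - {\<mu>}) f"
    by (rule has_derivative_continuous_on) (rule has_derivative_at_withinI[OF der])
  have int: "(\<lambda>t. f (?p r t)) integrable_on {0..2*pi}" if "r \<in> {0<..<\<delta>}" for r
    by (rule integrable_continuous_real, rule continuous_on_compose2[OF cont_f])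
       (use p[OF that] in \<open>auto intro!: continuous_intros\<close>)
  have deriv: "((\<lambda>r. integral (cbox 0 (2*pi)) (\<lambda>t. f (?p r t))) has_derivative (\<lambda>h. 0))
      (at r within {0<..<\<delta>})" if r: "r \<in> {0<..<\<delta>}" for r
  proof -
    have "((\<lambda>r. integral (cbox 0 (2*pi)) (\<lambda>t. f (?p r t))) has_vector_derivative
        integral (cbox 0 (2*pi)) (\<lambda>t. cis t *\<^sub>C f' (?p r t))) (at r within {0<..<\<delta>})"
    proof (rule leibniz_rule_vector_derivative[OF _ _ _ r])
      fix s t :: real
      assume s: "s \<in> {0<..<\<delta>}"
      have "((\<lambda>r. ?p r t) has_vector_derivative cis t) (at s within {0<..<\<delta>})"
        by (auto intro!: derivative_eq_intros simp: has_vector_derivative_def scaleR_conv_of_real)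
      from vector_derivative_diff_chain_within[OF this has_derivative_at_withinI[OF der[OF p[OF s]]]]
      show "((\<lambda>r. f (?p r t)) has_vector_derivative cis t *\<^sub>C f' (?p s t)) (at s within {0<..<\<delta>})"
        by (simp add: o_def)
    next
      show "continuous_on ({0<..<\<delta>} \<times> cbox 0 (2 * pi)) (\<lambda>(r, t). cis t *\<^sub>C f' (?p r t))"
        unfolding split_beta
        by (intro continuous_on_scaleC continuous_on_compose2[OF cont] continuous_intros)
           (use p in auto)
    qed (use int in auto)
    moreover have "integral (cbox 0 (2*pi)) (\<lambda>t. cis t *\<^sub>C f' (?p r t)) = 0"
    proof -
      have "((\<lambda>t. (of_real r * (\<i> * cis t)) *\<^sub>C f' (?p r t)) has_integral
          f (?p r (2*pi)) - f (?p r 0)) {0..2*pi}"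
      proof (rule fundamental_theorem_of_calculus)
        fix t :: real
        have "((\<lambda>t. ?p r t) has_vector_derivative of_real r * (\<i> * cis t)) (at t within {0..2*pi})"
          by (auto intro!: derivative_eq_intros simp: has_vector_derivative_def scaleR_conv_of_real)
        from vector_derivative_diff_chain_within[OF this has_derivative_at_withinI[OF der[OF p[OF r]]]]
        show "((\<lambda>t. f (?p r t)) has_vector_derivative (of_real r * (\<i> * cis t)) *\<^sub>C f' (?p r t))
            (at t within {0..2*pi})"
          by (simp add: o_def)
      qed simp
      note * = has_integral_linear[OF this bounded_linear_scaleC_right[of "inverse (of_real r * \<i>)"]]
      have "((\<lambda>t. cis t *\<^sub>C f' (?p r t)) has_integral 0) {0..2*pi}"
      proof -
        have "inverse (of_real r * \<i>) * (of_real r * (\<i> * cis t)) = cis t" for t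
          using r by (simp add: field_simps)
        then have "(\<lambda>x. inverse (of_real r * \<i>) *\<^sub>C x) \<circ>
            (\<lambda>t. (of_real r * (\<i> * cis t)) *\<^sub>C f' (?p r t)) = (\<lambda>t. cis t *\<^sub>C f' (?p r t))"
          by (simp add: fun_eq_iff scaleC_scaleC del: inverse_mult_distrib)
        with * show ?thesis by simp
      qed
      then show ?thesis by (simp add: integral_unique)
    qed
    ultimately show ?thesis by (simp add: has_vector_derivative_def)
  qed
  then obtain J where J: "integral {0..2*pi} (\<lambda>t. f (?p r t)) = J" if "r \<in> {0<..<\<delta>}" for r
    using has_derivative_zero_constant[OF _ deriv] by (auto simp: convex_real_interval)
  show thesis
    by (rule that[of J]) (use J int in \<open>auto simp: has_integral_integrable_integral\<close>)
qed

section \<open>Isolated points of the spectrum lie on the unit circle\<close>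

lemma notin_spectrum_op_if_surj:
  fixes S :: "'a::complex_banach \<Rightarrow> 'a"
  assumes S: "bounded_clinear S" and "surj (shift_op S z)"
    and low: "\<And>x. c * norm x \<le> norm (shift_op S z x)" and c: "c > 0"
  shows "z \<notin> spectrum_op S"
proof -
  let ?B = "shift_op S z" and ?R = "inv (shift_op S z)"
  note B = bounded_clinearD[OF bounded_clinear_shift_op[OF S, of z]]
  have "inj ?B"
  proof (rule injI)
    fix x y assume "?B x = ?B y"
    then have "c * norm (x - y) \<le> 0" using low[of "x - y"] by (simp add: B)
    then show "x = y" using c by (simp add: mult_le_0_iff)
  qed
  then have RB: "?R (?B x) = x" for x by simp
  have BR: "?B (?R x) = x" for x using assms(2) by (rule surj_f_inv_f)
  have "bounded_clinear ?R"
    unfolding bounded_clinear_def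
  proof (intro conjI allI)
    show "bounded_linear ?R"
    proof (rule bounded_linear_intro[where K="1 / c"])
      show "?R (x + y) = ?R x + ?R y" for x y by (metis B(1) RB BR)
      show "?R (r *\<^sub>R x) = r *\<^sub>R ?R x" for r x by (metis B(4) RB BR)
      show "norm (?R x) \<le> norm x * (1 / c)" for x
        using low[of "?R x"] c by (simp add: BR field_simps)
    qed
    show "?R (k *\<^sub>C x) = k *\<^sub>C ?R x" for k x by (metis B(3) RB BR)
  qed
  with RB BR show ?thesis by (auto simp: spectrum_op_def fun_eq_iff intro!: exI[of _ ?R])
qed

text \<open>
  Solving \<open>(S - z) x = y\<close> amounts to finding a fixed point of
  \<open>x \<mapsto> (S - w)\<^sup>-\<^sup>1 (y - (w - z) x)\<close>, a contraction with ratio \<open>\<bar>w - z\<bar> / c\<close>.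
\<close>

lemma surj_shift_op_perturb:
  fixes S :: "'a::complex_banach \<Rightarrow> 'a"
  assumes S: "bounded_clinear S" and w: "w \<notin> spectrum_op S"
    and low: "\<And>x. c * norm x \<le> norm (shift_op S w x)" and near: "cmod (w - z) < c"
  shows "surj (shift_op S z)"
proof (rule surjI)
  have c: "c > 0" using near le_less_trans norm_ge_zero by blast
  note R = bounded_clinearD[OF bounded_clinear_resolvent_op[OF w]]
  have *: "\<exists>x. shift_op S z x = y" for y
  proof -
    let ?f = "\<lambda>x. resolvent_op S w (y - (w - z) *\<^sub>C x)"
    have "\<exists>!x. ?f x = x"
    proof (rule banach_fix_type[where c="cmod (w - z) / c"])
      show "\<forall>x x'. dist (?f x) (?f x') \<le> cmod (w - z) / c * dist x x'"
      proof (intro allI)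
        fix x x' :: 'a
        have "(y - (w - z) *\<^sub>C x) - (y - (w - z) *\<^sub>C x') = (w - z) *\<^sub>C (x' - x)"
          by (simp add: complex_vector.scale_right_diff_distrib)
        then have eq: "?f x - ?f x' = (w - z) *\<^sub>C resolvent_op S w (x' - x)"
          by (simp only: R(2)[symmetric] R(3)[symmetric])
        have "c * norm (resolvent_op S w (x' - x)) \<le> norm (x' - x)"
          using low[of "resolvent_op S w (x' - x)"] by (simp add: shift_op_resolvent_op[OF w])
        then show "dist (?f x) (?f x') \<le> cmod (w - z) / c * dist x x'"
          using c mult_left_mono[of "c * norm (resolvent_op S w (x' - x))" "norm (x' - x)" "cmod (w - z)"]
          unfolding dist_norm eq norm_scaleC by (simp add: norm_minus_commute[of x] field_simps)
      qed
    qed (use near c in auto)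
    then obtain x where "?f x = x" by blast
    then have "shift_op S w x = y - (w - z) *\<^sub>C x"
      by (metis shift_op_resolvent_op[OF w])
    then have "shift_op S z x = y"
      by (simp add: shift_op_def complex_vector.scale_left_diff_distrib algebra_simps)
    then show ?thesis by blast
  qed
  show "shift_op S z (SOME x. shift_op S z x = y) = y" for y
    by (rule someI_ex[OF *])
qed

text \<open>
  Off the unit circle, \<open>S - z\<close> is bounded below by one constant \<open>d / M\<close> for all \<open>z\<close> within distance
  \<open>d\<close> of \<open>\<mu>\<close>. Because \<open>\<mu>\<close> is isolated, some \<open>w\<close> outside the spectrum is closer to \<open>\<mu>\<close> than this
  constant, so invertibility passes from \<open>S - w\<close> to \<open>S - \<mu>\<close>.
\<close>

lemma isolated_in_spectrum_op_unimodular: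
  fixes S :: "'a::complex_banach \<Rightarrow> 'a"
  assumes S: "bounded_clinear S" and iso: "\<mu> isolated_in spectrum_op S"
    and lower: "\<And>z x. \<bar>cmod z - 1\<bar> * norm x \<le> M * norm (shift_op S z x)"
    and M: "M > 0"
  shows "cmod \<mu> = 1"
proof (rule ccontr)
  assume "cmod \<mu> \<noteq> 1"
  define d where "d = \<bar>cmod \<mu> - 1\<bar> / 2"
  have d: "d > 0" using \<open>cmod \<mu> \<noteq> 1\<close> by (simp add: d_def)
  have low: "d / M * norm x \<le> norm (shift_op S z x)" if "cmod (z - \<mu>) \<le> d" for z x
  proof -
    have "\<bar>cmod z - cmod \<mu>\<bar> \<le> d" using norm_triangle_ineq3[of z \<mu>] that by linarith
    then have "d \<le> \<bar>cmod z - 1\<bar>" unfolding d_def by (simp add: field_simps abs_if split: if_splits)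
    then have "d * norm x \<le> M * norm (shift_op S z x)"
      using lower[of z x] mult_right_mono[of d _ "norm x"] by (meson norm_ge_zero order_trans)
    then show ?thesis using M by (simp add: field_simps)
  qed
  obtain T where T: "open T" "T \<inter> spectrum_op S = {\<mu>}" and mem: "\<mu> \<in> spectrum_op S"
    using iso by (auto simp: isolated_in_def)
  then have "\<mu> islimpt UNIV" "\<mu> \<in> T" by (auto simp: islimpt_UNIV)
  moreover have "open (T \<inter> ball \<mu> (min d (d / M)))" "\<mu> \<in> ball \<mu> (min d (d / M))"
    using T d M by auto
  ultimately obtain w where "w \<in> T \<inter> ball \<mu> (min d (d / M))" "w \<noteq> \<mu>"
    unfolding islimpt_def by blast
  then have w: "w \<notin> spectrum_op S" "cmod (w - \<mu>) < d" "cmod (w - \<mu>) < d / M"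
    using T by (auto simp: dist_norm norm_minus_commute)
  have "surj (shift_op S \<mu>)"
    by (rule surj_shift_op_perturb[OF S w(1) low w(3)]) (use w in simp)
  then have "\<mu> \<notin> spectrum_op S"
    by (rule notin_spectrum_op_if_surj[OF S _ low]) (use d M in auto)
  with mem show False by contradiction
qed

section \<open>Ascent and descent at an isolated point\<close>

text \<open>
  If \<open>(S - \<mu>)\<^sup>2 x = 0\<close> then \<open>S\<^sup>n x = \<mu>\<^sup>n x + n \<mu>\<^sup>n\<^sup>-\<^sup>1 (S - \<mu>) x\<close>, which is unbounded in \<open>n\<close>
  unless the second term vanishes.
\<close>

lemma shift_op_squared_kernel:
  fixes S :: "'a::complex_banach \<Rightarrow> 'a"
  assumes S: "bounded_clinear S" and \<mu>: "cmod \<mu> = 1"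
    and M: "\<And>k x. norm ((S ^^ k) x) \<le> M * norm x"
    and x: "shift_op S \<mu> (shift_op S \<mu> x) = 0"
  shows "shift_op S \<mu> x = 0"
proof -
  let ?y = "shift_op S \<mu> x"
  have Sx: "S x = \<mu> *\<^sub>C x + ?y" and Sy: "S ?y = \<mu> *\<^sub>C ?y"
    using x by (simp_all add: shift_op_def)
  have pow: "(S ^^ n) x = \<mu> ^ n *\<^sub>C (x + real n *\<^sub>R (inverse \<mu> *\<^sub>C ?y))" for n
  proof (induction n)
    case 0
    show ?case by (simp add: scaleC_one)
  next
    case (Suc n)
    have "\<mu> \<noteq> 0" using \<mu> by auto
    have "(S ^^ Suc n) x = \<mu> ^ n *\<^sub>C (S x + real n *\<^sub>R (inverse \<mu> *\<^sub>C S ?y))"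
      by (simp add: Suc bounded_clinearD[OF S])
    also have "S x + real n *\<^sub>R (inverse \<mu> *\<^sub>C S ?y) = \<mu> *\<^sub>C x + (?y + real n *\<^sub>R ?y)"
      unfolding Sx Sy using \<open>\<mu> \<noteq> 0\<close> by (simp add: scaleC_scaleC scaleC_one)
    also have "?y + real n *\<^sub>R ?y = real (Suc n) *\<^sub>R ?y"
      by (simp add: scaleR_left_distrib)
    also have "\<dots> = \<mu> *\<^sub>C (real (Suc n) *\<^sub>R (inverse \<mu> *\<^sub>C ?y))"
      unfolding scaleR_scaleC scaleC_scaleC using \<open>\<mu> \<noteq> 0\<close> by (simp del: of_nat_Suc)
    finally have "(S ^^ Suc n) x = \<mu> ^ n *\<^sub>C (\<mu> *\<^sub>C (x + real (Suc n) *\<^sub>R (inverse \<mu> *\<^sub>C ?y)))"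
      by (simp only: scaleC_add_right)
    then show ?case by (simp only: scaleC_scaleC power_Suc mult.commute)
  qed
  have "norm (x + real n *\<^sub>R (inverse \<mu> *\<^sub>C ?y)) \<le> M * norm x" for n
    using M[of n x] \<mu> by (simp add: pow norm_scaleC norm_power)
  then have "inverse \<mu> *\<^sub>C ?y = 0" by (rule bounded_increments_eq_0)
  then show ?thesis using \<mu> by (auto simp: complex_vector.scale_eq_0_iff)
qed

text \<open>
  The witness \<open>a\<close> is the constant Laurent coefficient of \<open>(S - z)\<^sup>-\<^sup>1 x\<close> at \<open>\<mu>\<close>, and the claim says
  that the coefficient at \<open>(z - \<mu>)\<^sup>-\<^sup>2\<close> is 0. Below, \<open>J\<close>, \<open>E\<close> and \<open>D\<close> are \<open>2 \<pi>\<close> times the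
  coefficients at \<open>(z - \<mu>)\<^sup>0\<close>, \<open>(z - \<mu>)\<^sup>-\<^sup>1\<close> and \<open>(z - \<mu>)\<^sup>-\<^sup>2\<close>.
\<close>

lemma range_shift_op_squared:
  fixes S :: "'a::complex_banach \<Rightarrow> 'a"
  assumes S: "bounded_clinear S" and \<mu>: "cmod \<mu> = 1"
    and \<delta>: "\<delta> > 0" "ball \<mu> \<delta> \<inter> spectrum_op S \<subseteq> {\<mu>}"
    and lower: "\<And>z x. \<bar>cmod z - 1\<bar> * norm x \<le> M * norm (shift_op S z x)"
    and M: "M > 0"
  shows "\<exists>a. shift_op S \<mu> (shift_op S \<mu> a) = shift_op S \<mu> x"
proof -
  define A where "A = shift_op S \<mu>"
  have A: "bounded_clinear A" unfolding A_def by (rule bounded_clinear_shift_op[OF S])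
  define R where "R = (\<lambda>z. resolvent_op S z x)"
  let ?e = "\<lambda>r t. of_real r * cis t :: complex"
  have sub: "ball \<mu> \<delta> - {\<mu>} \<subseteq> - spectrum_op S" using \<delta>(2) by auto
  have "(R has_derivative (\<lambda>h. h *\<^sub>C resolvent_op S z (resolvent_op S z x))) (at z)"
    if "z \<in> ball \<mu> \<delta> - {\<mu>}" for z
  proof -
    have "z \<notin> spectrum_op S" using that sub by auto
    from has_derivative_subset[OF resolvent_op_has_derivative[OF this] sub]
    show ?thesis
      unfolding R_def at_within_open[OF that open_Diff[OF open_ball closed_singleton]] .
  qed
  then obtain J where J: "\<And>r. 0 < r \<Longrightarrow> r < \<delta> \<Longrightarrow>
      ((\<lambda>t. R (\<mu> + ?e r t)) has_integral J) {0..2*pi}"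
    using circle_integral_radius_independent[of \<mu> \<delta> R "\<lambda>z. resolvent_op S z (resolvent_op S z x)"]
      continuous_on_subset[OF continuous_on_resolvent_op_twice sub] by blast
  define E where "E = A J - (2 * pi) *\<^sub>R x"
  define D where "D = A E"
  \<comment> \<open>Multiplication by \<open>z - \<mu>\<close> is traded for \<open>A\<close>, so that radius independence is needed for the
    constant coefficient alone.\<close>
  have AR: "A (R (\<mu> + ?e r t)) - x = ?e r t *\<^sub>C R (\<mu> + ?e r t)" if "0 < r" "r < \<delta>" for r t
  proof -
    have "\<mu> + ?e r t \<in> ball \<mu> \<delta> - {\<mu>}" using that by (auto simp: dist_norm norm_mult)
    then have "shift_op S (\<mu> + ?e r t) (R (\<mu> + ?e r t)) = x"
      unfolding R_def using sub by (intro shift_op_resolvent_op) auto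
    then show ?thesis
      unfolding A_def shift_op_def by (simp add: scaleC_add_left algebra_simps)
  qed
  have int1: "((\<lambda>t. ?e r t *\<^sub>C R (\<mu> + ?e r t)) has_integral E) {0..2*pi}"
    if r: "0 < r" "r < \<delta>" for r
  proof -
    have "((\<lambda>t. x) has_integral (2 * pi) *\<^sub>R x) {0..2*pi}"
      using has_integral_const_real[of x 0 "2*pi"] by simp
    from has_integral_diff[OF has_integral_linear[OF J[OF r] bounded_clinearD(6)[OF A]] this]
    show ?thesis unfolding o_def AR[OF r] E_def .
  qed
  have int_cis: "((\<lambda>t. ?e r t *\<^sub>C x) has_integral 0) {0..2*pi}" for r
  proof -
    have "((\<lambda>t. cis t) has_integral - \<i> * cis (2*pi) - - \<i> * cis 0) {0..2*pi}"
      by (rule fundamental_theorem_of_calculus)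
         (auto intro!: derivative_eq_intros
           simp: has_vector_derivative_def scaleR_conv_of_real fun_eq_iff complex_eq_iff)
    from has_integral_linear[OF this bounded_linear_compose[OF
        bounded_linear_scaleC_left[of x] bounded_linear_mult_right[of "of_real r"]]]
    show ?thesis by (simp add: o_def)
  qed
  have int2: "((\<lambda>t. (?e r t)\<^sup>2 *\<^sub>C R (\<mu> + ?e r t)) has_integral D) {0..2*pi}"
    if r: "0 < r" "r < \<delta>" for r
  proof -
    have eq: "A (?e r t *\<^sub>C R (\<mu> + ?e r t)) - ?e r t *\<^sub>C x = (?e r t)\<^sup>2 *\<^sub>C R (\<mu> + ?e r t)" for t
    proof -
      have "A (?e r t *\<^sub>C R (\<mu> + ?e r t)) - ?e r t *\<^sub>C x = ?e r t *\<^sub>C (A (R (\<mu> + ?e r t)) - x)"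
        by (simp only: bounded_clinearD(3)[OF A] complex_vector.scale_right_diff_distrib)
      then show ?thesis unfolding AR[OF r] by (simp only: scaleC_scaleC power2_eq_square)
    qed
    from has_integral_diff[OF has_integral_linear[OF int1[OF r] bounded_clinearD(6)[OF A]] int_cis[of r]]
    show ?thesis unfolding o_def eq by (simp add: D_def)
  qed
  have bound: "norm (cnj \<mu> *\<^sub>C D + (of_real (r\<^sup>2)) *\<^sub>C E + (\<mu> * of_real (r\<^sup>2)) *\<^sub>C J) \<le>
      r * (2 + r) * (M * norm x) * (2 * pi)" if r: "0 < r" "r < \<delta>" for r
  proof -
    let ?g = "\<lambda>t. (cnj \<mu> * (?e r t)\<^sup>2 + of_real (r\<^sup>2) * ?e r t + \<mu> * of_real (r\<^sup>2)) *\<^sub>C R (\<mu> + ?e r t)"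
    have int: "(?g has_integral cnj \<mu> *\<^sub>C D + (of_real (r\<^sup>2)) *\<^sub>C E + (\<mu> * of_real (r\<^sup>2)) *\<^sub>C J) {0..2*pi}"
      using has_integral_add[OF has_integral_add[OF
        has_integral_linear[OF int2[OF r] bounded_linear_scaleC_right[of "cnj \<mu>"]]
        has_integral_linear[OF int1[OF r] bounded_linear_scaleC_right[of "of_real (r\<^sup>2)"]]]
        has_integral_linear[OF J[OF r] bounded_linear_scaleC_right[of "\<mu> * of_real (r\<^sup>2)"]]]
      by (simp add: o_def scaleC_scaleC scaleC_add_left)
    have norm_g: "norm (?g t) \<le> r * (2 + r) * (M * norm x)" for t
    proof -
      let ?z = "\<mu> + ?e r t"
      have "?z \<in> ball \<mu> \<delta> - {\<mu>}" using r by (auto simp: dist_norm norm_mult)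
      then have "shift_op S ?z (R ?z) = x"
        unfolding R_def using sub by (intro shift_op_resolvent_op) auto
      with lower[of ?z "R ?z"] have low: "\<bar>cmod ?z - 1\<bar> * norm (R ?z) \<le> M * norm x" by simp
      have "cnj \<mu> * \<mu> = 1" "?e r t * cnj (?e r t) = of_real (r\<^sup>2)"
        using \<mu> by (simp_all add: complex_norm_square[symmetric] mult.commute[of "cnj \<mu>"] norm_mult
            del: complex_cnj_mult)
      \<comment> \<open>This is why the weights \<open>cnj \<mu>\<close>, \<open>r\<^sup>2\<close> and \<open>\<mu> r\<^sup>2\<close> are the right ones: on the circle the
        quadratic equals \<open>(z - \<mu>) (\<bar>z\<bar>\<^sup>2 - 1)\<close>, which cancels the growth of the resolvent and leaves
        a factor \<open>r\<close>.\<close>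
      then have "cnj \<mu> * (?e r t)\<^sup>2 + of_real (r\<^sup>2) * ?e r t + \<mu> * of_real (r\<^sup>2) =
          ?e r t * (?z * cnj ?z - 1)"
        by (simp only: complex_cnj_add power2_eq_square) algebra
      also have "?z * cnj ?z - 1 = of_real ((cmod ?z - 1) * (cmod ?z + 1))"
        unfolding complex_norm_square[symmetric] by (simp add: algebra_simps power2_eq_square)
      finally have "norm (?g t) = r * (cmod ?z + 1) * (\<bar>cmod ?z - 1\<bar> * norm (R ?z))"
        using r by (simp add: norm_scaleC norm_mult abs_mult del: of_real_mult)
      also have "\<dots> \<le> r * (2 + r) * (M * norm x)"
      proof (rule mult_mono[OF mult_left_mono low])
        show "cmod ?z + 1 \<le> 2 + r" using norm_triangle_ineq[of \<mu> "?e r t"] \<mu> r by (simp add: norm_mult)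
      qed (use r in auto)
      finally show ?thesis .
    qed
    have "0 \<le> r * (2 + r) * (M * norm x)" using M r by simp
    from has_integral_bound[OF this int[folded box_real(2)] norm_g] show ?thesis by simp
  qed
  have "cnj \<mu> *\<^sub>C D = 0"
  proof -
    let ?l = "\<lambda>r::real. norm (cnj \<mu> *\<^sub>C D + (of_real (r\<^sup>2)) *\<^sub>C E + (\<mu> * of_real (r\<^sup>2)) *\<^sub>C J)"
    have "(?l \<longlongrightarrow> norm (cnj \<mu> *\<^sub>C D + (of_real (0\<^sup>2)) *\<^sub>C E + (\<mu> * of_real (0\<^sup>2)) *\<^sub>C J)) (at_right 0)"
      by (intro tendsto_intros bounded_bilinear.tendsto[OF bounded_bilinear_scaleC])
    moreover have "((\<lambda>r. r * (2 + r) * (M * norm x) * (2 * pi)) \<longlongrightarrow> 0 * (2 + 0) * (M * norm x) * (2 * pi))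
        (at_right 0)"
      by (intro tendsto_intros)
    moreover have "eventually (\<lambda>r. ?l r \<le> r * (2 + r) * (M * norm x) * (2 * pi)) (at_right 0)"
      using eventually_at_right_real[OF \<delta>(1)] by eventually_elim (use bound in auto)
    ultimately have "norm (cnj \<mu> *\<^sub>C D + (of_real (0\<^sup>2)) *\<^sub>C E + (\<mu> * of_real (0\<^sup>2)) *\<^sub>C J) \<le>
        0 * (2 + 0) * (M * norm x) * (2 * pi)"
      by (intro tendsto_le[OF trivial_limit_at_right_real])
    then show ?thesis by simp
  qed
  then have "D = 0" using \<mu> by (auto simp: complex_vector.scale_eq_0_iff)
  then have "A (A ((1 / (2 * pi)) *\<^sub>R J)) = A x"
    by (simp add: D_def E_def bounded_clinearD[OF A] field_simps)
  then show ?thesis unfolding A_def by blast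
qed

section \<open>Power bounded operators with a vanishing difference\<close>

theorem theorem3p1:
  fixes S T :: "'a::complex_banach \<Rightarrow> 'a"
    and m :: nat
  assumes "infinite_dimensional TYPE('a)"
    and "m \<ge> 1"
    and "bounded_clinear S"
    and "bounded_clinear T"
    and "triangle_op m T S = (\<lambda>x. 0)"
    and "power_bounded S"
    and "power_bounded T"
  shows "polaroid S"
  unfolding polaroid_def
proof (intro allI impI)
  fix \<mu>
  assume iso: "\<mu> isolated_in spectrum_op S"
  note S = \<open>bounded_clinear S\<close> and T = \<open>bounded_clinear T\<close>
  obtain M where M: "M \<ge> 0" "\<And>k x. norm ((S ^^ k) x) \<le> M * norm x"
    using power_boundedE S \<open>power_bounded S\<close> by blast
  obtain N where N: "N \<ge> 0" "\<And>k x. norm ((T ^^ k) x) \<le> N * norm x"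
    using power_boundedE T \<open>power_bounded T\<close> by blast
  \<comment> \<open>The summand 1 makes the constant positive, so that it can be divided by.\<close>
  define K where "K = M + N * N + 1"
  have K: "K > 0" using M N by (simp add: K_def add_nonneg_pos)
  have "T (S x) = x" for x
    using left_inverse_if_triangle_op_eq_0 assms by blast
  from shift_op_lower_bound[OF S T this M(2) N(2) M(1) N(1)]
  have lower: "\<bar>cmod z - 1\<bar> * norm x \<le> K * norm (shift_op S z x)" for z x
    by (rule order_trans) (simp add: K_def mult_right_mono)
  have \<mu>: "cmod \<mu> = 1"
    by (rule isolated_in_spectrum_op_unimodular[OF S iso lower K])
  obtain U where mem: "\<mu> \<in> spectrum_op S" and U: "open U" "U \<inter> spectrum_op S = {\<mu>}"
    using iso by (auto simp: isolated_in_def)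
  then obtain \<delta> where \<delta>: "\<delta> > 0" "ball \<mu> \<delta> \<subseteq> U" by (metis IntD1 insertI1 open_contains_ball)
  let ?A = "shift_op S \<mu>"
  have "{x. (?A ^^ 1) x = 0} = {x. (?A ^^ Suc 1) x = 0}"
    using shift_op_squared_kernel[OF S \<mu> M(2)] bounded_clinearD(5)[OF bounded_clinear_shift_op[OF S]]
    by auto
  then have "ascent ?A \<le> enat 1"
    unfolding ascent_def by (intro Inf_lower) auto
  moreover have "range (?A ^^ 1) = range (?A ^^ Suc 1)"
  proof -
    have "\<exists>a. ?A (?A a) = ?A x" for x
      by (rule range_shift_op_squared[OF S \<mu> \<delta>(1) _ lower K]) (use \<delta> U in auto)
    then show ?thesis by auto (metis rangeI)
  qed
  then have "descent ?A \<le> enat 1"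
    unfolding descent_def by (intro Inf_lower) auto
  ultimately show "pole_of_resolvent S \<mu>"
    using mem unfolding pole_of_resolvent_def by (meson enat_ord_simps(4) le_less_trans enat.distinct(1))
qed

end
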